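(* Let $\phi$ be an arithmetical statement and $\pi$ a proof strategy with initial capital $\varepsilon$. If the probability that $\phi$ is proved by $\pi$ is greater than $\varepsilon$, then $\phi$ is provable in $\mathsf{PA}$ (without any additional axioms).
   Context: $\mathsf{PA}$ denotes Peano arithmetic. For a finite set $A$ of natural numbers, a rational $\tau>0$ and an arithmetical formula $R(x)$ with one free variable, $(\forall_\tau x\in A)R(x)$ denotes the arithmetical statement "the proportion of elements $n$ of $A$ such that $\lnot R(n)$ holds is at most $\tau$"; here $A$ is represented by a formula $A(x)$ such that $\mathsf{PA}\vdash A(\bar n)$ for $n\in A$, $\mathsf{PA}\vdash \lnot A(\bar n)$ for $n\notin A$, and the cardinality of $A$ is provable in $\mathsf{PA}$. A proof strategy with initial capital $\varepsilon$ is a finite rooted tree whose nodes are labeled by pairs $(T,\delta)$, $T$ a set of formulas and $\delta$ a rational in $[0,1]$; the root is labeled $(\mathsf{PA},\varepsilon)$. Each non-leaf node is either deterministic: it has one child, labeled $(T\cup\{\psi\},\delta)$ where $\psi$ is obtained from $T$ by an inference rule (or is an axiom); or probabilistic: $T$ contains a formula $(\forall_\tau n\in A)R(n)$ with $\tau\le\delta$, and the node has one child for each $n\in A$, labeled $(T\cup\{R(\bar n)\},\delta-\tau)$. The strategy is identified with the random process that starts at the root and at each probabilistic node moves to a uniformly chosen child until a leaf is reached. The probability that $\phi$ is proved by $\pi$ is the total probability of the leaves whose formula set contains $\phi$. *)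

theory Defs
  imports "HOL-Probability.Probability_Mass_Function"
begin

section \<open>The language of arithmetic\<close>

text \<open>Variables are de Bruijn indices: below \<open>k\<close> enclosing quantifiers, \<open>Var i\<close> with \<open>i < k\<close> is
  bound by the \<open>i\<close>-th of them (counted from the inside) and \<open>Var (k + j)\<close> is the \<open>j\<close>-th free
  variable.\<close>

datatype tm = Var nat | Zero | Succ tm | Plus tm tm | Times tm tm

datatype fm = Eq tm tm | Fls | Imp fm fm | Forall fm

definition Neg :: "fm \<Rightarrow> fm" where "Neg \<phi> = Imp \<phi> Fls"
definition And :: "fm \<Rightarrow> fm \<Rightarrow> fm" where "And \<phi> \<psi> = Neg (Imp \<phi> (Neg \<psi>))"
definition Or :: "fm \<Rightarrow> fm \<Rightarrow> fm" where "Or \<phi> \<psi> = Imp (Neg \<phi>) \<psi>"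
definition Iff :: "fm \<Rightarrow> fm \<Rightarrow> fm" where "Iff \<phi> \<psi> = And (Imp \<phi> \<psi>) (Imp \<psi> \<phi>)"
definition Exists :: "fm \<Rightarrow> fm" where "Exists \<phi> = Neg (Forall (Neg \<phi>))"

definition Conj :: "fm list \<Rightarrow> fm" where "Conj \<phi>s = foldr And \<phi>s (Neg Fls)"
definition Disj :: "fm list \<Rightarrow> fm" where "Disj \<phi>s = foldr Or \<phi>s Fls"

text \<open>All free indices are smaller than \<open>k\<close>.\<close>

primrec tm_below :: "nat \<Rightarrow> tm \<Rightarrow> bool" where
  "tm_below k (Var i) = (i < k)"
| "tm_below k Zero = True"
| "tm_below k (Succ t) = tm_below k t"
| "tm_below k (Plus s t) = (tm_below k s \<and> tm_below k t)"
| "tm_below k (Times s t) = (tm_below k s \<and> tm_below k t)"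

primrec fm_below :: "nat \<Rightarrow> fm \<Rightarrow> bool" where
  "fm_below k (Eq s t) = (tm_below k s \<and> tm_below k t)"
| "fm_below k Fls = True"
| "fm_below k (Imp \<phi> \<psi>) = (fm_below k \<phi> \<and> fm_below k \<psi>)"
| "fm_below k (Forall \<phi>) = fm_below (Suc k) \<phi>"

abbreviation sentence :: "fm \<Rightarrow> bool" where "sentence \<phi> \<equiv> fm_below 0 \<phi>"

text \<open>A formula with one free variable \<open>x\<close> has no free variable except possibly \<open>x = Var 0\<close>.\<close>

abbreviation unary :: "fm \<Rightarrow> bool" where "unary \<phi> \<equiv> fm_below 1 \<phi>"

text \<open>Lifting makes room for a new variable with index \<open>c\<close>.\<close>

primrec lift_tm :: "nat \<Rightarrow> tm \<Rightarrow> tm" where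
  "lift_tm c (Var i) = (if i < c then Var i else Var (Suc i))"
| "lift_tm c Zero = Zero"
| "lift_tm c (Succ t) = Succ (lift_tm c t)"
| "lift_tm c (Plus s t) = Plus (lift_tm c s) (lift_tm c t)"
| "lift_tm c (Times s t) = Times (lift_tm c s) (lift_tm c t)"

primrec lift_fm :: "nat \<Rightarrow> fm \<Rightarrow> fm" where
  "lift_fm c (Eq s t) = Eq (lift_tm c s) (lift_tm c t)"
| "lift_fm c Fls = Fls"
| "lift_fm c (Imp \<phi> \<psi>) = Imp (lift_fm c \<phi>) (lift_fm c \<psi>)"
| "lift_fm c (Forall \<phi>) = Forall (lift_fm (Suc c) \<phi>)"

text \<open>Substitution of \<open>u\<close> for the variable \<open>k\<close>, which disappears: larger indices decrease by one.\<close>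

primrec subst_tm :: "nat \<Rightarrow> tm \<Rightarrow> tm \<Rightarrow> tm" where
  "subst_tm k u (Var i) = (if i < k then Var i else if i = k then u else Var (i - 1))"
| "subst_tm k u Zero = Zero"
| "subst_tm k u (Succ t) = Succ (subst_tm k u t)"
| "subst_tm k u (Plus s t) = Plus (subst_tm k u s) (subst_tm k u t)"
| "subst_tm k u (Times s t) = Times (subst_tm k u s) (subst_tm k u t)"

primrec subst_fm :: "nat \<Rightarrow> tm \<Rightarrow> fm \<Rightarrow> fm" where
  "subst_fm k u (Eq s t) = Eq (subst_tm k u s) (subst_tm k u t)"
| "subst_fm k u Fls = Fls"
| "subst_fm k u (Imp \<phi> \<psi>) = Imp (subst_fm k u \<phi>) (subst_fm k u \<psi>)"
| "subst_fm k u (Forall \<phi>) = Forall (subst_fm (Suc k) (lift_tm 0 u) \<phi>)"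

abbreviation inst :: "fm \<Rightarrow> tm \<Rightarrow> fm" where "inst \<phi> u \<equiv> subst_fm 0 u \<phi>"

primrec numl :: "nat \<Rightarrow> tm" where
  "numl 0 = Zero"
| "numl (Suc n) = Succ (numl n)"


section \<open>First-order logic with equality and Peano arithmetic\<close>

inductive logical_axiom :: "fm \<Rightarrow> bool" where
  "logical_axiom (Imp \<phi> (Imp \<psi> \<phi>))"
| "logical_axiom (Imp (Imp \<phi> (Imp \<psi> \<theta>)) (Imp (Imp \<phi> \<psi>) (Imp \<phi> \<theta>)))"
| "logical_axiom (Imp (Neg (Neg \<phi>)) \<phi>)"
| "logical_axiom (Imp (Forall \<phi>) (inst \<phi> t))"
| "logical_axiom (Imp (Forall (Imp \<phi> \<psi>)) (Imp (Forall \<phi>) (Forall \<psi>)))"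
| "logical_axiom (Imp \<phi> (Forall (lift_fm 0 \<phi>)))"
| "logical_axiom (Eq t t)"
| "logical_axiom (Imp (Eq s t) (Imp (inst \<phi> s) (inst \<phi> t)))"

inductive infer :: "fm set \<Rightarrow> fm \<Rightarrow> bool" where
  axiom: "logical_axiom \<psi> \<Longrightarrow> infer T \<psi>"
| modus_ponens: "\<phi> \<in> T \<Longrightarrow> Imp \<phi> \<psi> \<in> T \<Longrightarrow> infer T \<psi>"
| generalization: "\<phi> \<in> T \<Longrightarrow> infer T (Forall \<phi>)"

inductive provable :: "fm set \<Rightarrow> fm \<Rightarrow> bool" (infix "\<turnstile>" 50) for T where
  hyp: "\<phi> \<in> T \<Longrightarrow> T \<turnstile> \<phi>"
| infer: "infer S \<psi> \<Longrightarrow> (\<And>\<theta>. \<theta> \<in> S \<Longrightarrow> T \<turnstile> \<theta>) \<Longrightarrow> T \<turnstile> \<psi>"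

text \<open>In the context of \<open>\<phi>\<close>, \<open>Var 0\<close> is the induction variable and all other variables are
  parameters; \<open>inst (lift_fm 1 \<phi>) (Succ (Var 0))\<close> is \<open>\<phi>(x + 1)\<close> in the same context.\<close>

definition induction_fm :: "fm \<Rightarrow> fm" where
  "induction_fm \<phi> =
     Imp (inst \<phi> Zero)
       (Imp (Forall (Imp \<phi> (inst (lift_fm 1 \<phi>) (Succ (Var 0))))) (Forall \<phi>))"

inductive_set PA :: "fm set" where
  "Forall (Neg (Eq (Succ (Var 0)) Zero)) \<in> PA"
| "Forall (Forall (Imp (Eq (Succ (Var 1)) (Succ (Var 0))) (Eq (Var 1) (Var 0)))) \<in> PA"
| "Forall (Eq (Plus (Var 0) Zero) (Var 0)) \<in> PA"
| "Forall (Forall (Eq (Plus (Var 1) (Succ (Var 0))) (Succ (Plus (Var 1) (Var 0))))) \<in> PA"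
| "Forall (Eq (Times (Var 0) Zero) Zero) \<in> PA"
| "Forall (Forall (Eq (Times (Var 1) (Succ (Var 0))) (Plus (Times (Var 1) (Var 0)) (Var 1)))) \<in> PA"
| "sentence ((Forall ^^ k) (induction_fm \<phi>)) \<Longrightarrow> (Forall ^^ k) (induction_fm \<phi>) \<in> PA"


section \<open>Counting and proportions\<close>

text \<open>Both formulas are meant for unary \<open>P\<close>: as \<open>P\<close> only contains \<open>x = Var 0\<close>, it needs no lifting
  below the witnesses \<open>y\<^sub>0, \<dots>, y\<^bsub>k-1\<^esub>\<close>, which are \<open>Var 1, \<dots>, Var k\<close> in the scope of \<open>\<forall>x\<close> and
  \<open>Var 0, \<dots>, Var (k - 1)\<close> outside it.\<close>

definition at_most :: "nat \<Rightarrow> fm \<Rightarrow> fm" where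
  "at_most k P =
     (Exists ^^ k) (Forall (Imp P (Disj (map (\<lambda>i. Eq (Var 0) (Var (Suc i))) [0..<k]))))"

definition exactly :: "nat \<Rightarrow> fm \<Rightarrow> fm" where
  "exactly k P =
     (Exists ^^ k)
       (And (Conj [Neg (Eq (Var i) (Var j)). j \<leftarrow> [0..<k], i \<leftarrow> [0..<j]])
            (Forall (Iff P (Disj (map (\<lambda>i. Eq (Var 0) (Var (Suc i))) [0..<k])))))"

definition represents :: "fm \<Rightarrow> nat set \<Rightarrow> bool" where
  "represents \<alpha> A \<longleftrightarrow> unary \<alpha> \<and> finite A \<and>
     (\<forall>n\<in>A. PA \<turnstile> inst \<alpha> (numl n)) \<and> (\<forall>n. n \<notin> A \<longrightarrow> PA \<turnstile> Neg (inst \<alpha> (numl n))) \<and>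
     PA \<turnstile> exactly (card A) \<alpha>"

text \<open>The formula \<open>(\<forall>\<^sub>\<tau> x \<in> A) R(x)\<close>, where \<open>\<alpha>\<close> represents \<open>A\<close> and \<open>N\<close> is the cardinality of \<open>A\<close>:
  the number of \<open>x \<in> A\<close> with \<open>\<not> R(x)\<close>, being an integer, is at most \<open>\<tau> N\<close> iff it is at most
  \<open>\<lfloor>\<tau> N\<rfloor>\<close>.\<close>

definition forall_prop :: "rat \<Rightarrow> nat \<Rightarrow> fm \<Rightarrow> fm \<Rightarrow> fm" where
  "forall_prop \<tau> N \<alpha> R = at_most (nat \<lfloor>\<tau> * of_nat N\<rfloor>) (And \<alpha> (Neg R))"

text \<open>In the standard model these formulas have the intended meaning.\<close>

primrec eval_tm :: "(nat \<Rightarrow> nat) \<Rightarrow> tm \<Rightarrow> nat" where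
  "eval_tm e (Var i) = e i"
| "eval_tm e Zero = 0"
| "eval_tm e (Succ t) = Suc (eval_tm e t)"
| "eval_tm e (Plus s t) = eval_tm e s + eval_tm e t"
| "eval_tm e (Times s t) = eval_tm e s * eval_tm e t"

primrec sat :: "(nat \<Rightarrow> nat) \<Rightarrow> fm \<Rightarrow> bool" where
  "sat e (Eq s t) \<longleftrightarrow> eval_tm e s = eval_tm e t"
| "sat e Fls \<longleftrightarrow> False"
| "sat e (Imp \<phi> \<psi>) \<longleftrightarrow> (sat e \<phi> \<longrightarrow> sat e \<psi>)"
| "sat e (Forall \<phi>) \<longleftrightarrow> (\<forall>n. sat (case_nat n e) \<phi>)"

lemma sat_connectives [simp]:
  "sat e (Neg \<phi>) \<longleftrightarrow> \<not> sat e \<phi>"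
  "sat e (And \<phi> \<psi>) \<longleftrightarrow> sat e \<phi> \<and> sat e \<psi>"
  "sat e (Or \<phi> \<psi>) \<longleftrightarrow> sat e \<phi> \<or> sat e \<psi>"
  "sat e (Iff \<phi> \<psi>) \<longleftrightarrow> (sat e \<phi> \<longleftrightarrow> sat e \<psi>)"
  "sat e (Exists \<phi>) \<longleftrightarrow> (\<exists>n. sat (case_nat n e) \<phi>)"
  by (auto simp: Neg_def And_def Or_def Iff_def Exists_def)

lemma sat_Conj [simp]: "sat e (Conj \<phi>s) \<longleftrightarrow> (\<forall>\<phi>\<in>set \<phi>s. sat e \<phi>)"
  by (induction \<phi>s) (auto simp: Conj_def)

lemma sat_Disj [simp]: "sat e (Disj \<phi>s) \<longleftrightarrow> (\<exists>\<phi>\<in>set \<phi>s. sat e \<phi>)"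
  by (induction \<phi>s) (auto simp: Disj_def)

lemma eval_tm_cong: "tm_below k t \<Longrightarrow> (\<And>i. i < k \<Longrightarrow> e i = e' i) \<Longrightarrow> eval_tm e t = eval_tm e' t"
  by (induction t) auto

lemma sat_cong: "fm_below k \<phi> \<Longrightarrow> (\<And>i. i < k \<Longrightarrow> e i = e' i) \<Longrightarrow> sat e \<phi> \<longleftrightarrow> sat e' \<phi>"
proof (induction \<phi> arbitrary: k e e')
  case (Eq s t)
  then show ?case using eval_tm_cong[of k s e e'] eval_tm_cong[of k t e e'] by simp
next
  case (Imp \<phi> \<psi>)
  then show ?case using Imp.IH(1)[of k e e'] Imp.IH(2)[of k e e'] by simp
next
  case (Forall \<phi>)
  have "sat (case_nat n e) \<phi> \<longleftrightarrow> sat (case_nat n e') \<phi>" for n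
    using Forall.prems by (intro Forall.IH[of "Suc k"]) (auto split: nat.split)
  then show ?case by simp
qed simp

lemma sat_Exists_pow:
  "sat e ((Exists ^^ k) \<phi>) \<longleftrightarrow> (\<exists>y. sat (\<lambda>i. if i < k then y i else e (i - k)) \<phi>)"
proof (induction k arbitrary: e)
  case (Suc k)
  have env: "(\<lambda>i. if i < k then y i else case_nat n e (i - k)) =
      (\<lambda>i. if i < Suc k then (y(k := n)) i else e (i - Suc k))" for y n
  proof
    fix i
    consider "i < k" | "i = k" | m where "i = Suc (k + m)"
      using nat_neq_iff[of i k] less_imp_Suc_add[of k i] by blast
    then show "(if i < k then y i else case_nat n e (i - k)) =
        (if i < Suc k then (y(k := n)) i else e (i - Suc k))"
      by cases simp_all
  qed
  have "sat e ((Exists ^^ Suc k) \<phi>) \<longleftrightarrow>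
      (\<exists>n y. sat (\<lambda>i. if i < Suc k then (y(k := n)) i else e (i - Suc k)) \<phi>)"
    by (simp add: Suc env)
  also have "\<dots> \<longleftrightarrow> (\<exists>y. sat (\<lambda>i. if i < Suc k then y i else e (i - Suc k)) \<phi>)"
    (is "(\<exists>n y. ?Q (y(k := n))) \<longleftrightarrow> (\<exists>y. ?Q y)")
  proof
    assume "\<exists>y. ?Q y"
    then obtain y where "?Q y" ..
    then have "?Q (y(k := y k))" unfolding fun_upd_triv .
    then show "\<exists>n y. ?Q (y(k := n))" by (intro exI)
  qed (elim exE, rule exI)
  finally show ?case .
qed simp

lemma sat_witnesses:
  "sat (case_nat n (\<lambda>i. if i < k then y i else e (i - k)))
     (Disj (map (\<lambda>i. Eq (Var 0) (Var (Suc i))) [0..<k])) \<longleftrightarrow> n \<in> y ` {..<k}"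
  unfolding sat_Disj set_map set_upt atLeast0LessThan bex_simps by (simp add: image_iff)

lemma sat_at_most:
  assumes "unary P"
  shows "sat e (at_most k P) \<longleftrightarrow>
    finite {n. sat (case_nat n e) P} \<and> card {n. sat (case_nat n e) P} \<le> k"
proof -
  define B where "B = {n. sat (case_nat n e) P}"
  have P: "sat (case_nat n e') P \<longleftrightarrow> n \<in> B" for n e'
    using sat_cong[OF assms, of "case_nat n e'" "case_nat n e"] by (simp add: B_def)
  have "sat e (at_most k P) \<longleftrightarrow> (\<exists>y :: nat \<Rightarrow> nat. B \<subseteq> y ` {..<k})"
    unfolding at_most_def sat_Exists_pow sat.simps P sat_witnesses subset_iff ..
  also have "\<dots> \<longleftrightarrow> finite B \<and> card B \<le> k"
  proof (intro iffI conjI; (elim exE conjE)?)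
    fix y :: "nat \<Rightarrow> nat" assume y: "B \<subseteq> y ` {..<k}"
    then show "finite B" by (rule finite_subset) simp
    show "card B \<le> k"
      using card_mono[OF _ y] card_image_le[of "{..<k}" y] by simp
  next
    assume "finite B" "card B \<le> k"
    obtain y where "bij_betw y {0..<card B} B"
      using ex_bij_betw_nat_finite[OF \<open>finite B\<close>] ..
    then have "y ` {0..<card B} = B" by (rule bij_betw_imp_surj_on)
    moreover have "y ` {0..<card B} \<subseteq> y ` {..<k}"
      using \<open>card B \<le> k\<close> by (intro image_mono) auto
    ultimately have "B \<subseteq> y ` {..<k}" by simp
    then show "\<exists>y :: nat \<Rightarrow> nat. B \<subseteq> y ` {..<k}" by blast
  qed
  finally show ?thesis by (simp add: B_def)
qed

lemma sat_exactly:
  assumes "unary P"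
  shows "sat e (exactly k P) \<longleftrightarrow>
    finite {n. sat (case_nat n e) P} \<and> card {n. sat (case_nat n e) P} = k"
proof -
  define B where "B = {n. sat (case_nat n e) P}"
  have P: "sat (case_nat n e') P \<longleftrightarrow> n \<in> B" for n e'
    using sat_cong[OF assms, of "case_nat n e'" "case_nat n e"] by (simp add: B_def)
  have D: "sat (\<lambda>i. if i < k then y i else e (i - k))
      (Conj [Neg (Eq (Var i) (Var j)). j \<leftarrow> [0..<k], i \<leftarrow> [0..<j]]) \<longleftrightarrow> inj_on y {..<k}" for y
  proof -
    have "sat (\<lambda>i. if i < k then y i else e (i - k))
        (Conj [Neg (Eq (Var i) (Var j)). j \<leftarrow> [0..<k], i \<leftarrow> [0..<j]]) \<longleftrightarrow>
        (\<forall>j\<in>{0..<k}. \<forall>i\<in>{0..<j}. y i \<noteq> y j)"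
      by simp
    also have "\<dots> \<longleftrightarrow> inj_on y {..<k}"
    proof
      assume "\<forall>j\<in>{0..<k}. \<forall>i\<in>{0..<j}. y i \<noteq> y j"
      then show "inj_on y {..<k}" by (intro linorder_inj_onI') simp
    next
      assume "inj_on y {..<k}"
      then show "\<forall>j\<in>{0..<k}. \<forall>i\<in>{0..<j}. y i \<noteq> y j"
        by (auto dest: inj_onD)
    qed
    finally show ?thesis .
  qed
  have "sat e (exactly k P) \<longleftrightarrow> (\<exists>y. inj_on y {..<k} \<and> y ` {..<k} = B)"
    unfolding exactly_def sat_Exists_pow sat_connectives sat.simps D P sat_witnesses by blast
  also have "\<dots> \<longleftrightarrow> finite B \<and> card B = k"
  proof (intro iffI conjI; (elim exE conjE)?)
    assume "finite B" "card B = k"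
    then show "\<exists>y. inj_on y {..<k} \<and> y ` {..<k} = B"
      using ex_bij_betw_nat_finite[of B] by (auto simp: bij_betw_def atLeast0LessThan)
  qed (auto simp: card_image)
  finally show ?thesis by (simp add: B_def)
qed

lemma sat_forall_prop:
  assumes "unary \<alpha>" "unary R" "finite A" "A \<noteq> {}" "\<tau> > 0"
    and "\<And>n. sat (case_nat n e) \<alpha> \<longleftrightarrow> n \<in> A"
  shows "sat e (forall_prop \<tau> (card A) \<alpha> R) \<longleftrightarrow>
    of_nat (card {n \<in> A. \<not> sat (case_nat n e) R}) / of_nat (card A) \<le> \<tau>"
proof -
  have "unary (And \<alpha> (Neg R))" using assms(1,2) by (simp add: And_def Neg_def)
  then have "sat e (forall_prop \<tau> (card A) \<alpha> R) \<longleftrightarrow>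
      card {n \<in> A. \<not> sat (case_nat n e) R} \<le> nat \<lfloor>\<tau> * of_nat (card A)\<rfloor>"
    using assms(3) by (simp add: forall_prop_def sat_at_most assms(6))
  also have "\<dots> \<longleftrightarrow> of_nat (card {n \<in> A. \<not> sat (case_nat n e) R}) \<le> \<tau> * of_nat (card A)"
    using assms(5) by (simp add: le_nat_iff le_floor_iff)
  also have "\<dots> \<longleftrightarrow> of_nat (card {n \<in> A. \<not> sat (case_nat n e) R}) / of_nat (card A) \<le> \<tau>"
    using assms(3,4) by (simp add: pos_divide_le_eq card_gt_0_iff)
  finally show ?thesis .
qed


section \<open>Proof strategies\<close>

datatype 'l rtree = Node (label: 'l) (children: "'l rtree list")

type_synonym strategy_tree = "(fm set \<times> rat) rtree"

inductive valid_tree :: "strategy_tree \<Rightarrow> bool" where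
  leaf: "0 \<le> \<delta> \<Longrightarrow> \<delta> \<le> 1 \<Longrightarrow> valid_tree (Node (T, \<delta>) [])"
| deterministic:
    "0 \<le> \<delta> \<Longrightarrow> \<delta> \<le> 1 \<Longrightarrow> infer T \<psi> \<Longrightarrow> label t = (T \<union> {\<psi>}, \<delta>) \<Longrightarrow> valid_tree t \<Longrightarrow>
     valid_tree (Node (T, \<delta>) [t])"
| probabilistic:
    "0 \<le> \<delta> \<Longrightarrow> \<delta> \<le> 1 \<Longrightarrow> 0 < \<tau> \<Longrightarrow> \<tau> \<le> \<delta> \<Longrightarrow> A \<noteq> {} \<Longrightarrow> represents \<alpha> A \<Longrightarrow> unary R \<Longrightarrow>
     forall_prop \<tau> (card A) \<alpha> R \<in> T \<Longrightarrow> distinct ns \<Longrightarrow> set ns = A \<Longrightarrow>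
     map label ts = map (\<lambda>n. (T \<union> {inst R (numl n)}, \<delta> - \<tau>)) ns \<Longrightarrow>
     (\<And>t. t \<in> set ts \<Longrightarrow> valid_tree t) \<Longrightarrow> valid_tree (Node (T, \<delta>) ts)"

definition proof_strategy :: "rat \<Rightarrow> strategy_tree \<Rightarrow> bool" where
  "proof_strategy \<epsilon> \<pi> \<longleftrightarrow> label \<pi> = (PA, \<epsilon>) \<and> valid_tree \<pi>"

text \<open>The distribution of the label of the leaf that is reached by moving, at every inner node, to
  a uniformly chosen child. The only child of a deterministic node is chosen with probability 1.\<close>

primrec run :: "'l rtree \<Rightarrow> 'l pmf" where
  "run (Node l ts) =
     (if ts = [] then return_pmf l
      else bind_pmf (pmf_of_set {..<length ts}) (\<lambda>i. map run ts ! i))"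

definition prob_proved :: "strategy_tree \<Rightarrow> fm \<Rightarrow> real" where
  "prob_proved \<pi> \<phi> = measure_pmf.prob (run \<pi>) {(T, \<delta>). \<phi> \<in> T}"

end

theory Submission
  imports Defs
begin

text \<open>By induction on the tree, a node labelled \<open>(T, \<delta>)\<close> from which \<open>\<phi>\<close> is proved with probability
  greater than \<open>\<delta>\<close> satisfies \<open>T \<turnstile> \<phi>\<close>. At a probabilistic node for \<open>(\<forall>\<^sub>\<tau> n \<in> A) R(n)\<close>, averaging shows
  that more than \<open>\<tau> |A|\<close> of the children \<open>n\<close> prove \<open>\<phi>\<close> with probability greater than \<open>\<delta> - \<tau>\<close>, as
  otherwise the total probability would be at most \<open>\<tau> + (1 - \<tau>)(\<delta> - \<tau>) \<le> \<delta>\<close>. For these \<open>n\<close> the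
  induction hypothesis gives \<open>T \<turnstile> R(n) \<longrightarrow> \<phi>\<close>, so \<open>T\<close> together with \<open>\<not> \<phi>\<close> refutes \<open>R(n)\<close> for too many \<open>n\<close>,
  which contradicts \<open>(\<forall>\<^sub>\<tau> n \<in> A) R(n)\<close> by the pigeonhole principle.\<close>

section \<open>Substitution\<close>

lemma subst_lift_tm [simp]: "subst_tm k u (lift_tm k t) = t"
  by (induction t) auto

lemma lift_tm_below: "tm_below k t \<Longrightarrow> lift_tm k t = t"
  by (induction t) auto

lemma lift_fm_below: "fm_below k \<phi> \<Longrightarrow> lift_fm k \<phi> = \<phi>"
  by (induction \<phi> arbitrary: k) (auto simp: lift_tm_below)

lemma lift_numl [simp]: "lift_tm k (numl n) = numl n"
  by (induction n) auto

lemma subst_numl [simp]: "subst_tm k u (numl n) = numl n"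
  by (induction n) auto

lemma numl_below [simp]: "tm_below k (numl n)"
  by (induction n) auto

lemma subst_tm_numl_below: "tm_below (Suc k) t \<Longrightarrow> tm_below k (subst_tm k (numl n) t)"
  by (induction t) auto

lemma subst_fm_numl_below: "fm_below (Suc k) \<phi> \<Longrightarrow> fm_below k (subst_fm k (numl n) \<phi>)"
  by (induction \<phi> arbitrary: k) (auto simp: subst_tm_numl_below)

lemma subst_fm_Neg [simp]: "subst_fm k u (Neg \<phi>) = Neg (subst_fm k u \<phi>)"
  by (simp add: Neg_def)

lemma subst_fm_And [simp]: "subst_fm k u (And \<phi> \<psi>) = And (subst_fm k u \<phi>) (subst_fm k u \<psi>)"
  by (simp add: And_def)

lemma subst_fm_Disj [simp]: "subst_fm k u (Disj \<phi>s) = Disj (map (subst_fm k u) \<phi>s)"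
  by (induction \<phi>s) (auto simp: Disj_def Or_def)


section \<open>Derivations without generalization\<close>

text \<open>Without the generalization rule, the deduction theorem holds for open formulas, too.\<close>

inductive entails :: "fm set \<Rightarrow> fm \<Rightarrow> bool" (infix "\<tturnstile>" 50) for H where
  hyp: "\<phi> \<in> H \<Longrightarrow> H \<tturnstile> \<phi>"
| axiom: "logical_axiom \<phi> \<Longrightarrow> H \<tturnstile> \<phi>"
| modus_ponens: "H \<tturnstile> Imp \<phi> \<psi> \<Longrightarrow> H \<tturnstile> \<phi> \<Longrightarrow> H \<tturnstile> \<psi>"

lemma entails_mono: "H \<tturnstile> \<phi> \<Longrightarrow> H \<subseteq> H' \<Longrightarrow> H' \<tturnstile> \<phi>"
proof (induction rule: entails.induct)
  case (modus_ponens \<phi> \<psi>)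
  then show ?case by (intro entails.modus_ponens[of _ \<phi> \<psi>])
qed (auto intro: entails.hyp entails.axiom)

lemma entails_insertI: "H \<tturnstile> \<phi> \<Longrightarrow> insert \<psi> H \<tturnstile> \<phi>"
  by (erule entails_mono) blast

lemma entails_Imp_const: "H \<tturnstile> \<phi> \<Longrightarrow> H \<tturnstile> Imp \<psi> \<phi>"
  by (rule entails.modus_ponens[OF entails.axiom[OF logical_axiom.intros(1)]])

lemma entails_Imp_distrib:
  "H \<tturnstile> Imp \<phi> (Imp \<psi> \<theta>) \<Longrightarrow> H \<tturnstile> Imp \<phi> \<psi> \<Longrightarrow> H \<tturnstile> Imp \<phi> \<theta>"
  by (rule entails.modus_ponens[OF entails.modus_ponens[OF entails.axiom[OF logical_axiom.intros(2)]]])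

lemma entails_Imp_refl: "H \<tturnstile> Imp \<phi> \<phi>"
  by (rule entails_Imp_distrib[where \<psi> = "Imp \<phi> \<phi>"])
    (rule entails.axiom, rule logical_axiom.intros)+

lemma entails_deduction: "insert \<phi> H \<tturnstile> \<psi> \<Longrightarrow> H \<tturnstile> Imp \<phi> \<psi>"
proof (induction rule: entails.induct)
  case (modus_ponens \<psi> \<theta>)
  show ?case by (rule entails_Imp_distrib) fact+
qed (auto intro: entails_Imp_refl entails_Imp_const entails.hyp entails.axiom)

section \<open>Derived propositional rules\<close>

lemma entails_NegI: "insert \<phi> H \<tturnstile> Fls \<Longrightarrow> H \<tturnstile> Neg \<phi>"
  unfolding Neg_def by (rule entails_deduction)

lemma entails_NegE: "H \<tturnstile> Neg \<phi> \<Longrightarrow> H \<tturnstile> \<phi> \<Longrightarrow> H \<tturnstile> Fls"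
  unfolding Neg_def by (rule entails.modus_ponens)

lemma entails_classical: "insert (Neg \<phi>) H \<tturnstile> Fls \<Longrightarrow> H \<tturnstile> \<phi>"
  by (rule entails.modus_ponens[OF entails.axiom[OF logical_axiom.intros(3)]]) (rule entails_NegI)

lemma entails_FlsE: "H \<tturnstile> Fls \<Longrightarrow> H \<tturnstile> \<phi>"
  by (rule entails_classical) (rule entails_insertI)

lemma entails_NegNegI:
  assumes "H \<tturnstile> \<phi>"
  shows "H \<tturnstile> Neg (Neg \<phi>)"
  by (rule entails_NegI, rule entails_NegE[OF _ entails_insertI[OF assms]])
    (simp add: entails.hyp)

lemma entails_contrapos:
  assumes "H \<tturnstile> Imp \<phi> \<psi>" "H \<tturnstile> Neg \<psi>"
  shows "H \<tturnstile> Neg \<phi>"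
proof (rule entails_NegI)
  have "insert \<phi> H \<tturnstile> \<psi>"
    by (rule entails.modus_ponens[OF entails_insertI[OF assms(1)]]) (simp add: entails.hyp)
  then show "insert \<phi> H \<tturnstile> Fls" by (rule entails_NegE[OF entails_insertI[OF assms(2)]])
qed

lemma entails_AndI:
  assumes "H \<tturnstile> \<phi>" "H \<tturnstile> \<psi>"
  shows "H \<tturnstile> And \<phi> \<psi>"
  unfolding And_def
proof (rule entails_NegI)
  let ?H = "insert (Imp \<phi> (Neg \<psi>)) H"
  have "?H \<tturnstile> Neg \<psi>"
    by (rule entails.modus_ponens[of _ \<phi>]) (simp_all add: entails.hyp entails_insertI assms)
  then show "?H \<tturnstile> Fls" by (rule entails_NegE) (rule entails_insertI[OF assms(2)])
qed

text \<open>Since \<open>Or\<close> is an implication from \<open>Neg \<phi>\<close>, adding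
  \<open>Neg \<phi>\<close> to the hypotheses leaves the disjunction of the tail, to which the
  induction applies. The cases \<phi> and \<not> \<phi> are then merged classically.\<close>

lemma entails_DisjE:
  assumes "H \<tturnstile> Disj \<phi>s" "\<And>\<phi>. \<phi> \<in> set \<phi>s \<Longrightarrow> insert \<phi> H \<tturnstile> \<psi>"
  shows "H \<tturnstile> \<psi>"
  using assms
proof (induction \<phi>s arbitrary: H)
  case Nil
  then show ?case by (simp add: Disj_def entails_FlsE)
next
  case (Cons \<phi> \<phi>s)
  have neg: "insert (Neg \<phi>) H \<tturnstile> \<psi>"
  proof (rule Cons.IH)
    have "H \<tturnstile> Imp (Neg \<phi>) (Disj \<phi>s)" using Cons.prems(1) by (simp add: Disj_def Or_def)
    then show "insert (Neg \<phi>) H \<tturnstile> Disj \<phi>s"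
      by (rule entails.modus_ponens[OF entails_insertI]) (simp add: entails.hyp)
  next
    fix \<theta> assume "\<theta> \<in> set \<phi>s"
    then have "insert \<theta> H \<tturnstile> \<psi>" using Cons.prems(2) by simp
    then show "insert \<theta> (insert (Neg \<phi>) H) \<tturnstile> \<psi>" by (rule entails_mono) blast
  qed
  have "H \<tturnstile> Imp \<phi> \<psi>" using Cons.prems(2) by (intro entails_deduction) simp
  then have "insert (Neg \<psi>) H \<tturnstile> Neg \<phi>"
    by (rule entails_contrapos[OF entails_insertI]) (simp add: entails.hyp)
  moreover have "insert (Neg \<psi>) H \<tturnstile> Imp (Neg \<phi>) \<psi>"
    using neg by (rule entails_insertI[OF entails_deduction])
  ultimately have "insert (Neg \<psi>) H \<tturnstile> \<psi>" by (rule entails.modus_ponens[rotated])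
  then have "insert (Neg \<psi>) H \<tturnstile> Fls"
    by (rule entails_NegE[rotated]) (simp add: entails.hyp)
  then show ?case by (rule entails_classical)
qed

text \<open>Simultaneous case distinction: one disjunct is selected from each of finitely many
  disjunctions, and \<open>f\<close> is the selection. \<open>H\<close> stays arbitrary in the
  induction because each step adds the selected disjunct to it.\<close>

lemma entails_choice:
  assumes "finite S" "\<And>n. n \<in> S \<Longrightarrow> H \<tturnstile> Disj (\<Phi> n)"
    and "\<And>f. (\<And>n. n \<in> S \<Longrightarrow> f n \<in> set (\<Phi> n)) \<Longrightarrow> f ` S \<union> H \<tturnstile> \<psi>"
  shows "H \<tturnstile> \<psi>"
  using assms
proof (induction S arbitrary: H rule: finite_induct)
  case empty
  then show ?case by simp
next
  case (insert m S)
  show ?case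
  proof (rule entails_DisjE)
    show "H \<tturnstile> Disj (\<Phi> m)" using insert.prems(1) by simp
  next
    fix \<phi> assume \<phi>: "\<phi> \<in> set (\<Phi> m)"
    show "insert \<phi> H \<tturnstile> \<psi>"
    proof (rule insert.IH)
      show "insert \<phi> H \<tturnstile> Disj (\<Phi> n)" if "n \<in> S" for n
        using insert.prems(1) that by (blast intro: entails_insertI)
    next
      fix f assume f: "\<And>n. n \<in> S \<Longrightarrow> f n \<in> set (\<Phi> n)"
      \<comment> \<open>Overriding at \<open>m\<close> extends the selection to the new element; as
        \<open>m\<close> is not in \<open>S\<close>, the choices on \<open>S\<close> are
        kept.\<close>
      have "(f(m := \<phi>)) ` insert m S \<union> H \<tturnstile> \<psi>"
        using f \<phi> by (intro insert.prems(2)) auto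
      moreover have "(f(m := \<phi>)) ` insert m S \<union> H = f ` S \<union> insert \<phi> H"
        using insert.hyps(2) by auto
      ultimately show "f ` S \<union> insert \<phi> H \<tturnstile> \<psi>" by (simp only:)
    qed
  qed
qed

section \<open>Instantiation and equality\<close>

lemma entails_inst: "H \<tturnstile> Forall \<phi> \<Longrightarrow> H \<tturnstile> inst \<phi> t"
  by (rule entails.modus_ponens[OF entails.axiom[OF logical_axiom.intros(4)]])

lemma entails_Leibniz: "H \<tturnstile> Eq s t \<Longrightarrow> H \<tturnstile> inst \<phi> s \<Longrightarrow> H \<tturnstile> inst \<phi> t"
  by (rule entails.modus_ponens[OF entails.modus_ponens[OF entails.axiom[OF logical_axiom.intros(8)]]])

lemma entails_sym: "H \<tturnstile> Eq s t \<Longrightarrow> H \<tturnstile> Eq t s"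
  \<comment> \<open>The Leibniz formula is \<open>x = s\<close>; lifting protects \<open>s\<close>
    from the substitution for \<open>x\<close>.\<close>
  using entails_Leibniz[of H s t "Eq (Var 0) (lift_tm 0 s)"]
    entails.axiom[OF logical_axiom.intros(7), of H s] by simp

lemma entails_trans: "H \<tturnstile> Eq s t \<Longrightarrow> H \<tturnstile> Eq t u \<Longrightarrow> H \<tturnstile> Eq s u"
  using entails_Leibniz[of H t u "Eq (lift_tm 0 s) (Var 0)"] by simp


section \<open>Provability\<close>

lemma provable_axiom: "logical_axiom \<phi> \<Longrightarrow> T \<turnstile> \<phi>"
  by (rule provable.infer[of "{}"]) (auto intro: infer.intros)

lemma provable_mp: "T \<turnstile> Imp \<phi> \<psi> \<Longrightarrow> T \<turnstile> \<phi> \<Longrightarrow> T \<turnstile> \<psi>"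
  by (rule provable.infer[of "{Imp \<phi> \<psi>, \<phi>}"]) (auto intro: infer.intros)

lemma provable_gen: "T \<turnstile> \<phi> \<Longrightarrow> T \<turnstile> Forall \<phi>"
  by (rule provable.infer[of "{\<phi>}"]) (auto intro: infer.intros)

lemma provable_cut: "T' \<turnstile> \<phi> \<Longrightarrow> (\<And>\<theta>. \<theta> \<in> T' \<Longrightarrow> T \<turnstile> \<theta>) \<Longrightarrow> T \<turnstile> \<phi>"
proof (induction rule: provable.induct)
  case (infer S \<psi>)
  show ?case by (rule provable.infer[OF infer.hyps(1) infer.IH[OF _ infer.prems]])
qed

lemma provable_mono: "T' \<turnstile> \<phi> \<Longrightarrow> T' \<subseteq> T \<Longrightarrow> T \<turnstile> \<phi>"
  by (erule provable_cut) (simp add: provable.hyp subsetD)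

text \<open>The theorems of \<open>T\<close> include the logical axioms and are closed under modus
  ponens. Thus open assumptions can be introduced and discharged in \<open>entails\<close> before
  returning to \<open>provable\<close>.\<close>

lemma provable_if_entails: "{\<theta>. T \<turnstile> \<theta>} \<tturnstile> \<phi> \<Longrightarrow> T \<turnstile> \<phi>"
proof (induction rule: entails.induct)
  case (modus_ponens \<phi> \<psi>)
  show ?case by (rule provable_mp[OF modus_ponens.IH])
qed (simp_all add: provable_axiom)

text \<open>Closedness of \<phi> matters in the generalization case: lifting leaves \<phi>
  unchanged, so vacuous quantification yields the implication from \<phi> to
  \<open>Forall \<phi>\<close>, and distributing the quantifier leads on to
  \<open>Forall \<theta>\<close>.\<close>

lemma deduction:
  assumes "insert \<phi> T \<turnstile> \<psi>" "sentence \<phi>"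
  shows "T \<turnstile> Imp \<phi> \<psi>"
  using assms(1)
proof (induction rule: provable.induct)
  case (hyp \<psi>)
  then consider "\<psi> = \<phi>" | "\<psi> \<in> T" by blast
  then show ?case
    by cases (simp_all add: provable_if_entails[OF entails_Imp_refl]
        provable_if_entails[OF entails_Imp_const[OF entails.hyp]] provable.hyp)
next
  case (infer S \<psi>)
  have const: "T \<turnstile> Imp \<phi> \<theta>" if "T \<turnstile> \<theta>" for \<theta>
    using that by (rule provable_mp[OF provable_axiom[OF logical_axiom.intros(1)]])
  have distrib: "T \<turnstile> Imp \<phi> \<xi>" if "T \<turnstile> Imp \<phi> (Imp \<theta> \<xi>)" "T \<turnstile> Imp \<phi> \<theta>" for \<theta> \<xi>
    using that by (rule provable_mp[OF provable_mp[OF provable_axiom[OF logical_axiom.intros(2)]]])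
  from infer.hyps(1) show ?case
  proof cases
    case axiom
    then show ?thesis by (intro const provable_axiom)
  next
    case (modus_ponens \<theta>)
    show ?thesis by (rule distrib; rule infer.IH) fact+
  next
    case (generalization \<theta>)
    have "T \<turnstile> Forall (Imp \<phi> \<theta>)" using infer.IH generalization(2) by (intro provable_gen)
    then have "T \<turnstile> Imp (Forall \<phi>) (Forall \<theta>)"
      by (rule provable_mp[OF provable_axiom[OF logical_axiom.intros(5)]])
    then have "T \<turnstile> Imp \<phi> (Imp (Forall \<phi>) (Forall \<theta>))" by (rule const)
    moreover have "T \<turnstile> Imp \<phi> (Forall \<phi>)"
      using provable_axiom[OF logical_axiom.intros(6), of T \<phi>] assms(2)
      by (simp add: lift_fm_below)
    ultimately show ?thesis unfolding generalization(1) by (rule distrib)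
  qed
qed

text \<open>The witnesses of the existential block are free variables in \<phi>, so they can be
  generalized one after the other.\<close>

lemma provable_Neg_Exists_pow:
  assumes "T \<turnstile> Neg \<phi>"
  shows "T \<turnstile> Neg ((Exists ^^ k) \<phi>)"
proof (induction k)
  case (Suc k)
  have "T \<turnstile> Forall (Neg ((Exists ^^ k) \<phi>))" using Suc by (rule provable_gen)
  then show ?case by (simp add: Exists_def[of "(Exists ^^ k) \<phi>"] provable_if_entails[OF entails_NegNegI[OF entails.hyp]])
qed (use assms in simp)


section \<open>Counting in arithmetic\<close>

text \<open>Injectivity of the successor strips \<open>m\<close> successors from both sides; what
  remains equates a successor with zero.\<close>

lemma entails_numl_neq:
  assumes H: "PA \<subseteq> H"
  shows "m < n \<Longrightarrow> H \<tturnstile> Neg (Eq (numl n) (numl m))"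
proof (induction m arbitrary: n)
  case 0
  then obtain l where n: "n = Suc l" using gr0_conv_Suc by blast
  have "H \<tturnstile> Forall (Neg (Eq (Succ (Var 0)) Zero))"
    using H by (auto intro: entails.hyp PA.intros)
  from entails_inst[OF this, of "numl l"] show ?case by (simp add: n)
next
  case (Suc m)
  then obtain l where n: "n = Suc l" "m < l" using Suc_lessE by blast
  have "H \<tturnstile> Forall (Forall (Imp (Eq (Succ (Var 1)) (Succ (Var 0))) (Eq (Var 1) (Var 0))))"
    using H by (intro entails.hyp) (auto intro: PA.intros)
  from entails_inst[OF entails_inst[OF this, of "numl l", simplified], of "numl m"]
  have "H \<tturnstile> Imp (Eq (Succ (numl l)) (Succ (numl m))) (Eq (numl l) (numl m))" by simp
  then show ?case unfolding n numl.simps by (rule entails_contrapos) (rule Suc.IH[OF n(2)])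
qed

lemma entails_numl_Eq_Fls:
  assumes "PA \<subseteq> H" "m \<noteq> n" "H \<tturnstile> Eq (numl m) (numl n)"
  shows "H \<tturnstile> Fls"
  using assms entails_numl_neq[of H m n] entails_numl_neq[of H n m]
  by (meson entails_NegE entails_sym linorder_neqE_nat)

text \<open>The \<open>k\<close> witnesses of \<open>at_most\<close> are kept as free variables.
  Each numeral from \<open>S\<close> equals one of them, so two distinct numerals equal the same
  variable, which \<open>PA\<close> refutes.\<close>

lemma pigeonhole_provable:
  assumes PA: "PA \<subseteq> T" and atm: "T \<turnstile> at_most k P"
    and S: "finite S" "k < card S" "\<And>n. n \<in> S \<Longrightarrow> T \<turnstile> inst P (numl n)"
  shows "T \<turnstile> Fls"
proof -
  define \<gamma> where "\<gamma> = Forall (Imp P (Disj (map (\<lambda>i. Eq (Var 0) (Var (Suc i))) [0..<k])))"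
  \<comment> \<open>\<gamma> may be open in the witness variables, so it is assumed in
    \<open>entails\<close>, over the theorems of \<open>T\<close>.\<close>
  define H where "H = insert \<gamma> {\<theta>. T \<turnstile> \<theta>}"
  have PA_H: "PA \<subseteq> H" using PA by (auto simp: H_def intro: provable.hyp)
  have "H \<tturnstile> Fls"
  proof (rule entails_choice[OF S(1)])
    fix n assume n: "n \<in> S"
    have "H \<tturnstile> \<gamma>" by (simp add: H_def entails.hyp)
    \<comment> \<open>Instantiating the outer quantifier shifts the witnesses from
      \<open>Var (Suc i)\<close> to \<open>Var i\<close>.\<close>
    then have "H \<tturnstile> Imp (inst P (numl n)) (Disj (map (\<lambda>i. Eq (numl n) (Var i)) [0..<k]))"
      unfolding \<gamma>_def by (auto dest: entails_inst[of _ _ "numl n"] simp: comp_def)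
    moreover have "H \<tturnstile> inst P (numl n)" using S(3)[OF n] by (simp add: H_def entails.hyp)
    ultimately show "H \<tturnstile> Disj (map (\<lambda>i. Eq (numl n) (Var i)) [0..<k])"
      by (rule entails.modus_ponens)
  next
    fix f assume "\<And>n. n \<in> S \<Longrightarrow> f n \<in> set (map (\<lambda>i. Eq (numl n) (Var i)) [0..<k])"
    then have "\<forall>n\<in>S. \<exists>i<k. f n = Eq (numl n) (Var i)" by fastforce
    then obtain g where g: "\<And>n. n \<in> S \<Longrightarrow> g n < k \<and> f n = Eq (numl n) (Var (g n))"
      by metis
    have "\<not> inj_on g S"
      using S(2) card_inj_on_le[of g S "{..<k}"] g by fastforce
    then obtain m n where mn: "m \<in> S" "n \<in> S" "m \<noteq> n" "g m = g n"
      by (auto simp: inj_on_def)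
    let ?H = "f ` S \<union> H"
    have "?H \<tturnstile> f m" "?H \<tturnstile> f n" using mn by (auto intro: entails.hyp)
    then have "?H \<tturnstile> Eq (numl m) (Var (g n))" "?H \<tturnstile> Eq (numl n) (Var (g n))"
      using g[OF mn(1)] g[OF mn(2)] mn(4) by auto
    then have "?H \<tturnstile> Eq (numl m) (numl n)" by (rule entails_trans[OF _ entails_sym])
    then show "?H \<tturnstile> Fls" using entails_numl_Eq_Fls[of ?H m n] PA_H mn(3) by blast
  qed
  then have "T \<turnstile> Neg \<gamma>" unfolding H_def by (intro provable_if_entails entails_NegI)
  then have "T \<turnstile> Neg (at_most k P)"
    unfolding at_most_def \<gamma>_def by (rule provable_Neg_Exists_pow)
  then show ?thesis using atm unfolding Neg_def by (rule provable_mp)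
qed


section \<open>Proof strategies\<close>

lemma prob_proved_leaf: "prob_proved (Node (T, \<delta>) []) \<phi> = (if \<phi> \<in> T then 1 else 0)"
  by (simp add: prob_proved_def)

lemma prob_proved_le_1: "prob_proved t \<phi> \<le> 1"
  by (simp add: prob_proved_def)

lemma prob_proved_node:
  assumes "ts \<noteq> []"
  shows "prob_proved (Node l ts) \<phi> = (\<Sum>i<length ts. prob_proved (ts ! i) \<phi>) / length ts"
proof -
  have ne: "{..<length ts} \<noteq> {}" using assms by auto
  have "prob_proved (Node l ts) \<phi> = measure_pmf.expectation (pmf_of_set {..<length ts})
      (\<lambda>i. measure_pmf.prob (map run ts ! i) {(T, \<delta>). \<phi> \<in> T})"
    using assms unfolding prob_proved_def run.simps if_not_P[OF assms] measure_pmf_bind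
    by (subst measure_pmf.measure_bind[where N = "count_space UNIV"])
      (auto simp: space_subprob_algebra subprob_space_measure_pmf)
  also have "\<dots> = (\<Sum>i<length ts. measure_pmf.prob (map run ts ! i) {(T, \<delta>). \<phi> \<in> T}) / length ts"
    using ne by (simp add: integral_pmf_of_set)
  finally show ?thesis by (simp add: prob_proved_def)
qed

text \<open>Otherwise at most \<tau>N values exceed \<delta> - \<tau>. Bounding these by 1 and the
  others by \<delta> - \<tau> forces the mean down to at most \<delta>.\<close>

lemma many_above_mean:
  fixes p :: "nat \<Rightarrow> real" and \<tau> \<delta> :: real
  assumes "0 < N" "\<And>i. i < N \<Longrightarrow> p i \<le> 1" "0 < \<tau>" "\<tau> \<le> \<delta>" "\<delta> \<le> 1"
    and mean: "(\<Sum>i<N. p i) / N > \<delta>"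
  shows "card {i. i < N \<and> \<delta> - \<tau> < p i} > \<tau> * N"
proof (rule ccontr)
  define B where "B = {i. i < N \<and> \<delta> - \<tau> < p i}"
  assume "\<not> ?thesis"
  then have B: "card B \<le> \<tau> * N" by (simp add: B_def)
  have B_sub: "B \<subseteq> {..<N}" by (auto simp: B_def)
  have "(\<Sum>i<N. p i) \<le> (\<Sum>i<N. (\<delta> - \<tau>) + (if i \<in> B then 1 - \<delta> + \<tau> else 0))"
    using assms(2) by (intro sum_mono) (auto simp: B_def not_less)
  also have "\<dots> = N * (\<delta> - \<tau>) + card B * (1 - \<delta> + \<tau>)"
    using B_sub by (simp add: sum.distrib sum.If_cases Int_absorb1)
  also have "\<dots> \<le> N * (\<delta> - \<tau>) + (\<tau> * N) * (1 - \<delta> + \<tau>)"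
    using B assms by (intro add_left_mono mult_right_mono) auto
  also have "\<dots> = N * \<delta> - N * (\<tau> * (\<delta> - \<tau>))" by (simp add: algebra_simps)
  \<comment> \<open>The dropped term is nonnegative because \<tau> \<le> \<delta>.\<close>
  also have "\<dots> \<le> N * \<delta>" using assms by simp
  finally show False using mean assms(1) by (simp add: field_simps)
qed

section \<open>From success probability to provability\<close>

lemma provable_forall_prop:
  assumes PA: "PA \<subseteq> T" and fp: "T \<turnstile> forall_prop \<tau> (card A) \<alpha> R"
    and rep: "represents \<alpha> A" and R: "unary R" and \<phi>: "sentence \<phi>"
    and S: "S \<subseteq> A" "\<tau> * of_nat (card A) < of_nat (card S)" "0 < \<tau>"
    and prv: "\<And>n. n \<in> S \<Longrightarrow> insert (inst R (numl n)) T \<turnstile> \<phi>"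
  shows "T \<turnstile> \<phi>"
proof -
  let ?T = "insert (Neg \<phi>) T"
  have "?T \<turnstile> Fls"
  proof (rule pigeonhole_provable)
    show "PA \<subseteq> ?T" using PA by blast
    show "?T \<turnstile> at_most (nat \<lfloor>\<tau> * of_nat (card A)\<rfloor>) (And \<alpha> (Neg R))"
      using fp unfolding forall_prop_def by (rule provable_mono) blast
    show "finite S" using S(1) rep by (auto simp: represents_def intro: finite_subset)
    \<comment> \<open>Nonnegativity makes the conversion by \<open>nat\<close> harmless, so a
      cardinality above \<tau>|A| is also above the bound used in the formula.\<close>
    have "0 \<le> \<tau> * of_nat (card A)" using S(3) by simp
    then show "nat \<lfloor>\<tau> * of_nat (card A)\<rfloor> < card S"
      using S(2) by (simp add: nat_less_iff floor_less_iff)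
  next
    fix n assume n: "n \<in> S"
    have "PA \<turnstile> inst \<alpha> (numl n)" using n S(1) rep by (auto simp: represents_def)
    then have \<alpha>: "?T \<turnstile> inst \<alpha> (numl n)" using PA by (rule provable_mono[OF _ subset_insertI2])
    \<comment> \<open>The deduction theorem for \<open>provable\<close> requires a closed
      hypothesis.\<close>
    have "sentence (inst R (numl n))" using R by (simp add: subst_fm_numl_below)
    then have "T \<turnstile> Imp (inst R (numl n)) \<phi>" using prv[OF n] by (simp add: deduction)
    then have "?T \<turnstile> Imp (inst R (numl n)) \<phi>" by (rule provable_mono) blast
    moreover have "?T \<turnstile> Neg \<phi>" by (simp add: provable.hyp)
    ultimately have "{\<theta>. ?T \<turnstile> \<theta>} \<tturnstile> Neg (inst R (numl n))"
      by (intro entails_contrapos[OF entails.hyp entails.hyp, of _ \<phi>]) simp_all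
    with \<alpha> show "?T \<turnstile> inst (And \<alpha> (Neg R)) (numl n)"
      by (intro provable_if_entails) (simp add: entails_AndI entails.hyp)
  qed
  then have "T \<turnstile> Imp (Neg \<phi>) Fls" using \<phi> by (intro deduction) (simp_all add: Neg_def)
  then have "T \<turnstile> Neg (Neg \<phi>)" by (simp only: Neg_def)
  then show ?thesis by (rule provable_mp[OF provable_axiom[OF logical_axiom.intros(3)]])
qed

text \<open>Nodes below the root may carry further formulas and a smaller capital, so the induction
  treats every \<open>T\<close> containing \<open>PA\<close> and every \<delta>.\<close>

lemma valid_tree_provable:
  assumes "valid_tree t" "label t = (T, \<delta>)" "PA \<subseteq> T" "sentence \<phi>"
    and "of_rat \<delta> < prob_proved t \<phi>"
  shows "T \<turnstile> \<phi>"
  using assms(1-3,5)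
proof (induction arbitrary: T \<delta> rule: valid_tree.induct)
  case (leaf \<delta>' T')
  \<comment> \<open>At a leaf the probability is 0 or 1, so exceeding a nonnegative \<delta> means
    that \<phi> is in \<open>T\<close>.\<close>
  then have "(0 :: real) \<le> of_rat \<delta>" by (simp add: zero_le_of_rat_iff)
  with leaf show ?case by (auto simp: prob_proved_leaf split: if_splits intro: provable.hyp)
next
  case (deterministic \<delta>' T' \<psi> t)
  then have [simp]: "T' = T" "\<delta>' = \<delta>" by auto
  have "T \<union> {\<psi>} \<turnstile> \<phi>"
    using deterministic by (intro deterministic.IH) (auto simp: prob_proved_node)
  \<comment> \<open>The formula added at the child is already provable from \<open>T\<close> and can
    be cut.\<close>
  moreover have "T \<turnstile> \<psi>" using deterministic.hyps(3) by (auto intro: provable.infer[of T] provable.hyp)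
  ultimately show ?case by (elim provable_cut) (auto intro: provable.hyp)
next
  case (probabilistic \<delta>' \<tau> A \<alpha> R T' ns ts)
  then have [simp]: "T' = T" "\<delta>' = \<delta>" by auto
  define p where "p i = prob_proved (ts ! i) \<phi>" for i
  define I where "I = {i. i < length ts \<and> of_rat \<delta> - of_rat \<tau> < p i}"
  have len: "length ts = length ns" using probabilistic.hyps(11) by (metis length_map)
  have cardA: "card A = length ts" using probabilistic.hyps(9,10) len distinct_card by metis
  have ne: "ts \<noteq> []" using probabilistic.hyps(5,10) len by auto
  have I: "of_rat \<tau> * real (length ts) < real (card I)"
    unfolding I_def
  proof (rule many_above_mean)
    show "of_rat \<delta> < (\<Sum>i<length ts. p i) / real (length ts)"
      using probabilistic.prems ne by (simp add: prob_proved_node p_def)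
  qed (use ne probabilistic.hyps in
      \<open>auto simp: p_def prob_proved_le_1 of_rat_less_eq of_rat_le_1_iff\<close>)
  \<comment> \<open>\<open>ns\<close> has no repetitions, so the good child indices yield equally
    many elements of \<open>A\<close>.\<close>
  have card_S: "card ((!) ns ` I) = card I"
    using probabilistic.hyps(9) by (intro card_image inj_on_subset[OF inj_on_nth[of ns "{..<length ns}"]])
      (auto simp: I_def len)
  show ?case
  proof (rule provable_forall_prop)
    show "PA \<subseteq> T" by fact
    show "T \<turnstile> forall_prop \<tau> (card A) \<alpha> R" using probabilistic.hyps(8) by (simp add: provable.hyp)
    show "represents \<alpha> A" "unary R" "sentence \<phi>" "0 < \<tau>"
      using probabilistic.hyps assms(4) by auto
    show "(!) ns ` I \<subseteq> A" using probabilistic.hyps(10) by (auto simp: I_def len)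
    \<comment> \<open>The averaging bound is real, whereas the proportion in the formula is
      rational; \<open>of_rat\<close> reflects the order.\<close>
    have "(of_rat (\<tau> * of_nat (card A)) :: real) < of_rat (of_nat (card I))"
      using I by (simp add: cardA of_rat_mult)
    then show "\<tau> * of_nat (card A) < of_nat (card ((!) ns ` I))"
      unfolding of_rat_less card_S .
  next
    fix n assume "n \<in> (!) ns ` I"
    then obtain i where i: "i < length ts" "of_rat \<delta> - of_rat \<tau> < p i" "n = ns ! i"
      by (auto simp: I_def)
    have "map label ts ! i = map (\<lambda>n. (T' \<union> {inst R (numl n)}, \<delta>' - \<tau>)) ns ! i"
      using probabilistic.hyps(11) by simp
    then have "label (ts ! i) = (insert (inst R (numl n)) T, \<delta> - \<tau>)" using i len by simp
    then show "insert (inst R (numl n)) T \<turnstile> \<phi>"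
      using i probabilistic.prems(2)
      by (intro probabilistic.IH[of "ts ! i"]) (auto simp: p_def of_rat_diff)
  qed
qed

theorem theorem2:
  fixes \<phi> :: fm and \<pi> :: strategy_tree and \<epsilon> :: rat
  assumes "sentence \<phi>"
    and "proof_strategy \<epsilon> \<pi>"
    and "prob_proved \<pi> \<phi> > of_rat \<epsilon>"
  shows "PA \<turnstile> \<phi>"
  using assms valid_tree_provable[of \<pi> PA \<epsilon> \<phi>] by (simp add: proof_strategy_def)

end
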